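(* Consider a graph of convex sets (GCS) on a graph $G=(\mathcal V,\mathcal E)$ with all sets $\mathcal X_v$ ($v\in\mathcal V$) and $\mathcal X_e$ ($e\in\mathcal E$) closed, convex and bounded, and with linear objective functions $f_v(\boldsymbol x_v)=\boldsymbol c_v^\top\boldsymbol x_v$ and $f_e(\boldsymbol x_v,\boldsymbol x_w)=\boldsymbol c_e^\top(\boldsymbol x_v,\boldsymbol x_w)$. Let $\mathcal H$ be a set of admissible subgraphs of $G$, let $\mathcal Y_{\mathcal H}=\{\boldsymbol y^H: H\in\mathcal H\}$, and let $\mathcal Y\subseteq\mathcal Y_{\mathrm{sub}}$ be a polytope that satisfies the incidence condition $\mathcal Y^{\mathrm{bin}}=\mathcal Y_{\mathcal H}$ or, when the objective functions $f_v$ for $v\in\mathcal V$ and $f_e$ for $e\in\mathcal E$ are nonnegative, the relaxed incidence condition $\mathcal Y^{\mathrm{bin}}+\mathbb Z_{\ge0}^{\mathcal V\cup\mathcal E}=\mathcal Y_{\mathcal H}+\mathbb Z_{\ge0}^{\mathcal V\cup\mathcal E}$. Consider the following mixed-integer convex program (MICP) in the variables $\boldsymbol y\in\mathbb R^{\mathcal V\cup\mathcal E}$, $\boldsymbol z_v\in\mathbb R^{n_v}$ for $v\in\mathcal V$, and $\boldsymbol z_v^e\in\mathbb R^{n_v}$ for $v\in\mathcal V$, $e\in\delta_v$: $$\begin{aligned} \text{minimize}\quad & \sum_{v\in\mathcal V}\boldsymbol c_v^\top\boldsymbol z_v+\sum_{e=[v,w]\in\mathcal E}\boldsymbol c_e^\top(\boldsymbol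 z_v^e,\boldsymbol z_w^e)\\ \text{subject to}\quad & \boldsymbol y\in\mathcal Y^{\mathrm{bin}},\\ & (\boldsymbol z_v^e,y_e)\in\tilde{\mathcal X}_v, && v\in\mathcal V,\ e\in\delta_v,\\ & (\boldsymbol z_v-\boldsymbol z_v^e,\,y_v-y_e)\in\tilde{\mathcal X}_v, && v\in\mathcal V,\ e\in\delta_v,\\ & (\boldsymbol z_v^e,\boldsymbol z_w^e,y_e)\in\tilde{\mathcal X}_e, && e=[v,w]\in\mathcal E. \end{aligned}$$ Then: 1. This MICP has the same optimal value as the GCS problem. 2. A subgraph $H$ is optimal for the GCS problem if and only if its incidence vector $\boldsymbol y$ is optimal for this MICP. 3. Optimal values of the continuous variables $\boldsymbol x_v$ associated with the subgraph $H$ are given by the optimal values of the MICP variables $\boldsymbol z_v$ for all $v\in\mathcal V$ such that $y_v=1$.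
   Context: Graph of convex sets. $G=(\mathcal V,\mathcal E)$ is a graph, directed or undirected, with vertex set $\mathcal V$ and edge set $\mathcal E\subset\mathcal V^2$. An edge (directed or undirected) with ends $v,w$ is written $e=[v,w]$. $\delta_v$ denotes the set of edges incident with vertex $v$. Each vertex $v$ has a variable $\boldsymbol x_v\in\mathbb R^{n_v}$, $n_v>0$, a constraint set $\mathcal X_v\subseteq\mathbb R^{n_v}$ and an objective function $f_v:\mathbb R^{n_v}\to\mathbb R$. Each edge $e=[v,w]$ has a constraint set $\mathcal X_e\subseteq\mathbb R^{n_v+n_w}$ and an objective function $f_e:\mathbb R^{n_v+n_w}\to\mathbb R$. GCS problem. A subgraph of $G$ is $H=(\mathcal W,\mathcal F)$ with $\mathcal W\subseteq\mathcal V$ and $\mathcal F\subseteq\mathcal W^2\cap\mathcal E$. Given a set $\mathcal H$ of (admissible) subgraphs, the GCS problem is $$\begin{aligned}\text{minimize}\quad&\sum_{v\in\mathcal W}f_v(\boldsymbol x_v)+\sum_{e=[v,w]\in\mathcal F}f_e(\boldsymbol x_v,\boldsymbol x_w)\\ \text{subject to}\quad& H=(\mathcal W,\mathcal F)\in\mathcal H,\\ &\boldsymbol x_v\in\mathcal X_v,\ v\in\mathcal W,\\ &(\boldsymbol x_v,\boldsymbol x_w)\in\mathcal X_e,\ e=[v,w]\in\mathcal F,\end{aligned}$$ with variables $H$ and $\boldsymbol x_v$ for $v\in\mathcal W$. Incidence vectors. The incidence vector $\boldsymbol y^H\in\{0,1\}^{\mathcal V\cup\mathcal E}$ of $H=(\mathcal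 W,\mathcal F)$ has $y^H_v=1$ if $v\in\mathcal W$ and $y^H_v=0$ otherwise, and $y^H_e=1$ if $e\in\mathcal F$ and $y^H_e=0$ otherwise. For a polytope $\mathcal Y\subseteq\mathbb R^{\mathcal V\cup\mathcal E}$, $\mathcal Y^{\mathrm{bin}}=\mathcal Y\cap\{0,1\}^{\mathcal V\cup\mathcal E}$. The subgraph polytope is $\mathcal Y_{\mathrm{sub}}=\{\boldsymbol y\in[0,1]^{\mathcal V\cup\mathcal E}: y_v\ge y_e\text{ for all }v\in\mathcal V\text{ and }e\in\delta_v\}$. $\mathbb Z_{\ge0}$ is the set of nonnegative integers, and a plus sign between sets denotes the Minkowski sum. Homogenization. For a compact convex set $\mathcal X\subset\mathbb R^n$, $\tilde{\mathcal X}=\{(\boldsymbol x,y)\in\mathbb R^{n+1}: y\ge0,\ \boldsymbol x\in y\mathcal X\}$, with $0\mathcal X=\{\boldsymbol 0\}$.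
   Formalization: Every vertex is assumed to have an incident edge (else z_v is unconstrained); under the relaxed incidence condition, item 2 is stated for H in the admissible set with y^H in Y and item 3 for admissible H; for other optimal H, a subgraph of H is shown optimal for both problems. *)

theory Defs
  imports "HOL-Analysis.Analysis" "HOL-Analysis.Finite_Function_Topology" "HOL-Library.Set_Algebras"
begin

text \<open>
  Since the dimensions \<open>n\<^sub>v\<close> vary with the vertex, \<open>\<real>\<^sup>n\<close> is the set of finitely supported
  functions on \<open>nat\<close> that vanish outside \<open>{..<n}\<close>, and \<open>\<real>\<close> to the power of a finite index set
  \<open>I\<close> is treated alike. The normed vector space structure of \<^typ>\<open>'i \<Rightarrow>\<^sub>0 real\<close> restricts on such a
  (closed) subspace to the usual vector space structure and topology, so
  \<^const>\<open>closed\<close>, \<^const>\<open>bounded\<close>, \<^const>\<open>convex\<close> and \<^const>\<open>polytope\<close> keep their usual meaning.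
  A point of \<open>\<real>\<^sup>m\<^sup>+\<^sup>n\<close> given by two blocks is a pair.
\<close>

type_synonym rvec = "nat \<Rightarrow>\<^sub>0 real"

definition coord_space :: "'i set \<Rightarrow> ('i \<Rightarrow>\<^sub>0 real) set" where
  "coord_space I = {x. Poly_Mapping.keys x \<subseteq> I}"

abbreviation Rn :: "nat \<Rightarrow> rvec set" where
  "Rn n \<equiv> coord_space {..<n}"

definition dotp :: "rvec \<Rightarrow> rvec \<Rightarrow> real" where
  "dotp c x = (\<Sum>i\<in>Poly_Mapping.keys c. Poly_Mapping.lookup c i * Poly_Mapping.lookup x i)"

definition homogenization :: "'a::real_vector set \<Rightarrow> ('a \<times> real) set" where
  "homogenization X = {(x, y). 0 \<le> y \<and> x \<in> (if y = 0 then {0} else (\<lambda>u. y *\<^sub>R u) ` X)}"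

text \<open>
  The blocks of a point of the constraint set of an edge are ordered, hence so are the ends of an
  edge. An edge is therefore a pair \<open>(v, w)\<close>; for an undirected graph every edge \<open>[v, w]\<close> is listed once,
  in the order that is used for its constraint set and objective. Nothing below
  depends on the direction of an edge otherwise.
\<close>

record 'v gcs =
  verts :: "'v set"
  edges :: "('v \<times> 'v) set"
  vdim :: "'v \<Rightarrow> nat"
  vset :: "'v \<Rightarrow> rvec set"
  eset :: "'v \<times> 'v \<Rightarrow> (rvec \<times> rvec) set"
  vobj :: "'v \<Rightarrow> rvec \<Rightarrow> real"
  eobj :: "'v \<times> 'v \<Rightarrow> rvec \<times> rvec \<Rightarrow> real"

definition gcs_wf :: "'v gcs \<Rightarrow> bool" where
  "gcs_wf G \<longleftrightarrow>
     finite (verts G) \<and> edges G \<subseteq> verts G \<times> verts G \<and>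
     (\<forall>v\<in>verts G. 0 < vdim G v \<and> vset G v \<subseteq> Rn (vdim G v)) \<and>
     (\<forall>(v, w)\<in>edges G. eset G (v, w) \<subseteq> Rn (vdim G v) \<times> Rn (vdim G w))"

definition incident_edges :: "'v gcs \<Rightarrow> 'v \<Rightarrow> ('v \<times> 'v) set" where
  "incident_edges G v = {e \<in> edges G. v = fst e \<or> v = snd e}"

type_synonym 'v subgr = "'v set \<times> ('v \<times> 'v) set"

definition is_subgraph :: "'v gcs \<Rightarrow> 'v subgr \<Rightarrow> bool" where
  "is_subgraph G H \<longleftrightarrow> fst H \<subseteq> verts G \<and> snd H \<subseteq> (fst H \<times> fst H) \<inter> edges G"

text \<open>
  A candidate solution is a pair \<open>(H, x)\<close>; the values of the function \<open>x\<close> outside the vertex set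
  of \<open>H\<close> play no role.
\<close>

definition gcs_feasible :: "'v gcs \<Rightarrow> 'v subgr set \<Rightarrow> ('v subgr \<times> ('v \<Rightarrow> rvec)) set" where
  "gcs_feasible G \<H> =
     {((W, F), x). (W, F) \<in> \<H> \<and> (\<forall>v\<in>W. x v \<in> vset G v) \<and>
        (\<forall>(v, w)\<in>F. (x v, x w) \<in> eset G (v, w))}"

fun gcs_cost :: "'v gcs \<Rightarrow> 'v subgr \<times> ('v \<Rightarrow> rvec) \<Rightarrow> real" where
  "gcs_cost G ((W, F), x) =
     (\<Sum>v\<in>W. vobj G v (x v)) + (\<Sum>(v, w)\<in>F. eobj G (v, w) (x v, x w))"

text \<open>The optimal values are extended reals, with \<open>\<infinity>\<close> for an infeasible problem.\<close>

definition gcs_value :: "'v gcs \<Rightarrow> 'v subgr set \<Rightarrow> ereal" where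
  "gcs_value G \<H> = (INF s\<in>gcs_feasible G \<H>. ereal (gcs_cost G s))"

definition gcs_solution :: "'v gcs \<Rightarrow> 'v subgr set \<Rightarrow> 'v subgr \<Rightarrow> ('v \<Rightarrow> rvec) \<Rightarrow> bool" where
  "gcs_solution G \<H> H x \<longleftrightarrow> is_arg_min (gcs_cost G) (\<lambda>s. s \<in> gcs_feasible G \<H>) (H, x)"

definition gcs_optimal_subgraph :: "'v gcs \<Rightarrow> 'v subgr set \<Rightarrow> 'v subgr \<Rightarrow> bool" where
  "gcs_optimal_subgraph G \<H> H \<longleftrightarrow> (\<exists>x. gcs_solution G \<H> H x)"

type_synonym 'v ivec = "('v + 'v \<times> 'v) \<Rightarrow>\<^sub>0 real"

abbreviation yv :: "'v ivec \<Rightarrow> 'v \<Rightarrow> real" where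
  "yv y v \<equiv> Poly_Mapping.lookup y (Inl v)"

abbreviation ye :: "'v ivec \<Rightarrow> 'v \<times> 'v \<Rightarrow> real" where
  "ye y e \<equiv> Poly_Mapping.lookup y (Inr e)"

definition gcs_index :: "'v gcs \<Rightarrow> ('v + 'v \<times> 'v) set" where
  "gcs_index G = verts G <+> edges G"

definition incidence_vector :: "'v subgr \<Rightarrow> 'v ivec" where
  "incidence_vector H = Abs_poly_mapping (\<lambda>i. if i \<in> fst H <+> snd H then 1 else 0)"

definition binary_points :: "'v gcs \<Rightarrow> 'v ivec set \<Rightarrow> 'v ivec set" where
  "binary_points G Y =
     Y \<inter> {y \<in> coord_space (gcs_index G). \<forall>i\<in>gcs_index G. Poly_Mapping.lookup y i \<in> {0, 1}}"

definition nonneg_int_points :: "'v gcs \<Rightarrow> 'v ivec set" where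
  "nonneg_int_points G =
     {y \<in> coord_space (gcs_index G). \<forall>i\<in>gcs_index G. Poly_Mapping.lookup y i \<in> \<nat>}"

definition subgraph_polytope :: "'v gcs \<Rightarrow> 'v ivec set" where
  "subgraph_polytope G =
     {y \<in> coord_space (gcs_index G).
        (\<forall>i\<in>gcs_index G. Poly_Mapping.lookup y i \<in> {0..1}) \<and>
        (\<forall>v\<in>verts G. \<forall>e\<in>incident_edges G v. yv y v \<ge> ye y e)}"

definition incidence_condition :: "'v gcs \<Rightarrow> 'v subgr set \<Rightarrow> 'v ivec set \<Rightarrow> bool" where
  "incidence_condition G \<H> Y \<longleftrightarrow> binary_points G Y = incidence_vector ` \<H>"

definition relaxed_incidence_condition :: "'v gcs \<Rightarrow> 'v subgr set \<Rightarrow> 'v ivec set \<Rightarrow> bool" where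
  "relaxed_incidence_condition G \<H> Y \<longleftrightarrow>
     binary_points G Y + nonneg_int_points G = incidence_vector ` \<H> + nonneg_int_points G"

definition linear_objectives ::
    "'v gcs \<Rightarrow> ('v \<Rightarrow> rvec) \<Rightarrow> ('v \<times> 'v \<Rightarrow> rvec \<times> rvec) \<Rightarrow> bool" where
  "linear_objectives G cv ce \<longleftrightarrow>
     (\<forall>v\<in>verts G. cv v \<in> Rn (vdim G v) \<and>
        (\<forall>x\<in>Rn (vdim G v). vobj G v x = dotp (cv v) x)) \<and>
     (\<forall>(v, w)\<in>edges G. ce (v, w) \<in> Rn (vdim G v) \<times> Rn (vdim G w) \<and>
        (\<forall>x\<in>Rn (vdim G v). \<forall>x'\<in>Rn (vdim G w).
           eobj G (v, w) (x, x') = dotp (fst (ce (v, w))) x + dotp (snd (ce (v, w))) x'))"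

text \<open>
  A linear function that is nonnegative on the whole space is zero; nonnegativity is required
  on the constraint sets only.
\<close>

definition nonneg_objectives :: "'v gcs \<Rightarrow> bool" where
  "nonneg_objectives G \<longleftrightarrow>
     (\<forall>v\<in>verts G. \<forall>x\<in>vset G v. 0 \<le> vobj G v x) \<and>
     (\<forall>e\<in>edges G. \<forall>p\<in>eset G e. 0 \<le> eobj G e p)"

text \<open>A candidate solution is \<open>(y, z, z')\<close>, where \<open>z' v e\<close> is the auxiliary copy of \<open>z v\<close> for the
  incident edge \<open>e\<close>.\<close>

type_synonym 'v micp_vars = "'v ivec \<times> ('v \<Rightarrow> rvec) \<times> ('v \<Rightarrow> 'v \<times> 'v \<Rightarrow> rvec)"

definition micp_feasible :: "'v gcs \<Rightarrow> 'v ivec set \<Rightarrow> 'v micp_vars set" where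
  "micp_feasible G Y =
     {(y, z, z').
        (\<forall>v\<in>verts G. z v \<in> Rn (vdim G v)) \<and>
        (\<forall>v\<in>verts G. \<forall>e\<in>incident_edges G v. z' v e \<in> Rn (vdim G v)) \<and>
        y \<in> binary_points G Y \<and>
        (\<forall>v\<in>verts G. \<forall>e\<in>incident_edges G v. (z' v e, ye y e) \<in> homogenization (vset G v)) \<and>
        (\<forall>v\<in>verts G. \<forall>e\<in>incident_edges G v.
           (z v - z' v e, yv y v - ye y e) \<in> homogenization (vset G v)) \<and>
        (\<forall>(v, w)\<in>edges G.
           ((z' v (v, w), z' w (v, w)), ye y (v, w)) \<in> homogenization (eset G (v, w)))}"

fun micp_cost ::
    "'v gcs \<Rightarrow> ('v \<Rightarrow> rvec) \<Rightarrow> ('v \<times> 'v \<Rightarrow> rvec \<times> rvec) \<Rightarrow> 'v micp_vars \<Rightarrow> real" where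
  "micp_cost G cv ce (y, z, z') =
     (\<Sum>v\<in>verts G. dotp (cv v) (z v)) +
     (\<Sum>(v, w)\<in>edges G.
        dotp (fst (ce (v, w))) (z' v (v, w)) + dotp (snd (ce (v, w))) (z' w (v, w)))"

definition micp_value ::
    "'v gcs \<Rightarrow> ('v \<Rightarrow> rvec) \<Rightarrow> ('v \<times> 'v \<Rightarrow> rvec \<times> rvec) \<Rightarrow> 'v ivec set \<Rightarrow> ereal" where
  "micp_value G cv ce Y = (INF s\<in>micp_feasible G Y. ereal (micp_cost G cv ce s))"

definition micp_solution ::
    "'v gcs \<Rightarrow> ('v \<Rightarrow> rvec) \<Rightarrow> ('v \<times> 'v \<Rightarrow> rvec \<times> rvec) \<Rightarrow> 'v ivec set \<Rightarrow>
     'v ivec \<Rightarrow> ('v \<Rightarrow> rvec) \<Rightarrow> ('v \<Rightarrow> 'v \<times> 'v \<Rightarrow> rvec) \<Rightarrow> bool" where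
  "micp_solution G cv ce Y y z z' \<longleftrightarrow>
     is_arg_min (micp_cost G cv ce) (\<lambda>s. s \<in> micp_feasible G Y) (y, z, z')"

definition micp_optimal_vector ::
    "'v gcs \<Rightarrow> ('v \<Rightarrow> rvec) \<Rightarrow> ('v \<times> 'v \<Rightarrow> rvec \<times> rvec) \<Rightarrow> 'v ivec set \<Rightarrow> 'v ivec \<Rightarrow> bool"
  where
  "micp_optimal_vector G cv ce Y y \<longleftrightarrow> (\<exists>z z'. micp_solution G cv ce Y y z z')"

end

theory Submission
  imports Defs
begin

text \<open>
  A binary point of \<open>Y\<close> is the incidence vector of a subgraph \<open>K\<close>, and at such a point the
  homogenized constraints force \<open>z' v e = z v\<close> for the edges of \<open>K\<close> and \<open>0\<close> for all other edges (here
  every vertex needs an incident edge, as otherwise \<open>z v\<close> is unconstrained). So the program is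
  the GCS problem over the set of subgraphs whose incidence vectors lie in \<open>Y\<close>. Under the
  relaxed incidence condition this set and \<open>\<H>\<close> have the same minimal elements, and
  since the objectives are nonnegative, passing to a smaller subgraph keeps a point feasible and does
  not increase its cost. Hence both problems have the value of the GCS problem over the
  intersection of the two sets.
\<close>

section \<open>Minimizers, homogenization at scales 0 and 1, finiteness\<close>

text \<open>Optimality becomes feasibility plus attainment of the extended-real value. In this form
  solutions carry over between problems whose values and costs agree.\<close>

lemma is_arg_min_iff_INF:
  fixes f :: "'a \<Rightarrow> real"
  shows "is_arg_min f (\<lambda>s. s \<in> S) s \<longleftrightarrow> s \<in> S \<and> ereal (f s) = (INF s\<in>S. ereal (f s))"
proof
  assume *: "is_arg_min f (\<lambda>s. s \<in> S) s"
  then have "ereal (f s) \<le> (INF s\<in>S. ereal (f s))"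
    by (intro INF_greatest) (auto simp: is_arg_min_linorder)
  with * show "s \<in> S \<and> ereal (f s) = (INF s\<in>S. ereal (f s))"
    by (auto simp: is_arg_min_def intro!: antisym INF_lower)
next
  assume *: "s \<in> S \<and> ereal (f s) = (INF s\<in>S. ereal (f s))"
  have "f s \<le> f t" if "t \<in> S" for t
    using * INF_lower[OF that, of "\<lambda>s. ereal (f s)"] by (metis ereal_less_eq(3))
  with * show "is_arg_min f (\<lambda>s. s \<in> S) s"
    by (auto simp: is_arg_min_linorder)
qed

text \<open>For binary \<open>y\<close> in the subgraph polytope, \<open>yv y v\<close>,
  \<open>ye y e\<close> and their difference at an incident edge are all 0 or 1, so homogenizations
  are only evaluated at these two scales.\<close>

lemma homogenization_0_iff: "(x, 0) \<in> homogenization X \<longleftrightarrow> x = 0"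
  by (simp add: homogenization_def)

lemma homogenization_1_iff: "(x, 1) \<in> homogenization X \<longleftrightarrow> x \<in> X"
  by (simp add: homogenization_def)

lemma dotp_zero_right [simp]: "dotp c 0 = 0"
  by (simp add: dotp_def)

lemma zero_in_coord_space [simp]: "0 \<in> coord_space I"
  by (simp add: coord_space_def)

lemma finite_edges: "gcs_wf G \<Longrightarrow> finite (edges G)"
  unfolding gcs_wf_def using finite_subset[of "edges G" "verts G \<times> verts G"] by simp

lemma edge_ends:
  assumes "gcs_wf G" "e \<in> edges G"
  shows "fst e \<in> verts G" "snd e \<in> verts G" "e \<in> incident_edges G (fst e)"
    "e \<in> incident_edges G (snd e)"
proof -
  have "e \<in> verts G \<times> verts G"
    using assms unfolding gcs_wf_def by blast
  with assms(2) show "fst e \<in> verts G" "snd e \<in> verts G" "e \<in> incident_edges G (fst e)"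
    "e \<in> incident_edges G (snd e)"
    by (auto simp: incident_edges_def)
qed

lemma vset_in_Rn: "gcs_wf G \<Longrightarrow> v \<in> verts G \<Longrightarrow> x \<in> vset G v \<Longrightarrow> x \<in> Rn (vdim G v)"
  unfolding gcs_wf_def by blast

lemma is_subgraph_finite:
  assumes "gcs_wf G" "is_subgraph G K"
  shows "finite (fst K)" "finite (snd K)"
proof -
  have "fst K \<subseteq> verts G" "snd K \<subseteq> edges G" "finite (verts G)"
    using assms by (auto simp: gcs_wf_def is_subgraph_def)
  then show "finite (fst K)" "finite (snd K)"
    using finite_edges[OF assms(1)] by (simp_all add: finite_subset)
qed


section \<open>Incidence vectors\<close>

text \<open>A subgraph is finite, so the indicator has finite support and
  \<open>Abs_poly_mapping\<close> represents it faithfully.\<close>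

lemma lookup_incidence_vector:
  assumes "gcs_wf G" "is_subgraph G K"
  shows "Poly_Mapping.lookup (incidence_vector K) i = (if i \<in> fst K <+> snd K then 1 else 0)"
proof -
  have "finite (fst K <+> snd K)"
    using is_subgraph_finite[OF assms] by simp
  then show ?thesis
    unfolding incidence_vector_def by (subst Abs_poly_mapping_inverse) auto
qed

lemma incidence_vector_inj:
  assumes "gcs_wf G" "is_subgraph G K" "is_subgraph G H" "incidence_vector K = incidence_vector H"
  shows "K = H"
proof -
  have "i \<in> fst K <+> snd K \<longleftrightarrow> i \<in> fst H <+> snd H" for i
    using lookup_incidence_vector[OF assms(1,2), of i] lookup_incidence_vector[OF assms(1,3), of i]
      assms(4) by (auto split: if_splits)
  then have "fst K = fst H" "snd K = snd H"
    by blast+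
  then show ?thesis
    by (rule prod_eqI)
qed

text \<open>The counterpart of \<open>\<H>\<close> determined by \<open>Y\<close>. When
  \<open>Y\<close> lies in the subgraph polytope, \<open>binary_points_eq\<close> shows that these
  subgraphs encode exactly the binary points.\<close>

definition subgraphs_in :: "'v gcs \<Rightarrow> 'v ivec set \<Rightarrow> 'v subgr set" where
  "subgraphs_in G Y = {K. is_subgraph G K \<and> incidence_vector K \<in> Y}"

lemma incidence_vector_in_binary_points_iff:
  assumes "gcs_wf G" "is_subgraph G K"
  shows "incidence_vector K \<in> binary_points G Y \<longleftrightarrow> incidence_vector K \<in> Y"
proof -
  have "fst K <+> snd K \<subseteq> gcs_index G"
    using assms(2) by (auto simp: is_subgraph_def gcs_index_def)
  then have "Poly_Mapping.keys (incidence_vector K) \<subseteq> gcs_index G"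
    by (auto simp: in_keys_iff lookup_incidence_vector[OF assms] split: if_splits)
  then show ?thesis
    by (auto simp: binary_points_def coord_space_def lookup_incidence_vector[OF assms])
qed

text \<open>The coordinates equal to 1 select vertices and edges. The inequality between
  \<open>yv y v\<close> and \<open>ye y e\<close> in the subgraph polytope forces both ends of a
  selected edge to be selected, which makes the selection a subgraph.\<close>

lemma binary_point_is_incidence_vector:
  assumes wf: "gcs_wf G" and Y: "Y \<subseteq> subgraph_polytope G" and y: "y \<in> binary_points G Y"
  obtains K where "K \<in> subgraphs_in G Y" "y = incidence_vector K"
proof
  let ?K = "({v\<in>verts G. yv y v = 1}, {e\<in>edges G. ye y e = 1})"
  have y': "Poly_Mapping.keys y \<subseteq> gcs_index G"
    "\<And>i. i \<in> gcs_index G \<Longrightarrow> Poly_Mapping.lookup y i \<in> {0, 1}" "y \<in> Y"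
    using y by (auto simp: binary_points_def coord_space_def)
  have end_selected: "yv y v = 1" if "v \<in> verts G" "e \<in> incident_edges G v" "ye y e = 1" for v e
  proof -
    have "ye y e \<le> yv y v"
      using subsetD[OF Y y'(3)] that(1,2) unfolding subgraph_polytope_def by blast
    moreover have "yv y v \<in> {0, 1}"
      using that y'(2)[of "Inl v"] by (auto simp: gcs_index_def)
    ultimately show ?thesis
      using that by auto
  qed
  have sub: "is_subgraph G ?K"
    unfolding is_subgraph_def fst_conv snd_conv
  proof (intro conjI subsetI IntI)
    fix e assume "e \<in> {e\<in>edges G. ye y e = 1}"
    then have e: "e \<in> edges G" "ye y e = 1"
      by auto
    show "e \<in> {v\<in>verts G. yv y v = 1} \<times> {v\<in>verts G. yv y v = 1}"
      using edge_ends[OF wf e(1)] end_selected[OF _ _ e(2)] by (simp add: mem_Times_iff)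
  qed auto
  have "Poly_Mapping.lookup y i = Poly_Mapping.lookup (incidence_vector ?K) i" for i
  proof (cases "i \<in> gcs_index G")
    case True
    then show ?thesis
      using y'(2)[OF True] by (auto simp: lookup_incidence_vector[OF wf sub] gcs_index_def)
  next
    case False
    then have "Poly_Mapping.lookup y i = 0"
      using y'(1) by (auto simp: in_keys_iff)
    with False show ?thesis
      by (auto simp: lookup_incidence_vector[OF wf sub] gcs_index_def)
  qed
  then show eq: "y = incidence_vector ?K"
    by (rule poly_mapping_eqI)
  then show "?K \<in> subgraphs_in G Y"
    using sub y'(3) by (simp add: subgraphs_in_def)
qed

lemma binary_points_eq:
  assumes "gcs_wf G" "Y \<subseteq> subgraph_polytope G"
  shows "binary_points G Y = incidence_vector ` subgraphs_in G Y"
proof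
  show "binary_points G Y \<subseteq> incidence_vector ` subgraphs_in G Y"
    using binary_point_is_incidence_vector[OF assms] by blast
  show "incidence_vector ` subgraphs_in G Y \<subseteq> binary_points G Y"
    using incidence_vector_in_binary_points_iff[OF assms(1)] by (auto simp: subgraphs_in_def)
qed

lemma incidence_condition_imp_eq:
  assumes "gcs_wf G" "Y \<subseteq> subgraph_polytope G" "\<forall>H\<in>\<H>. is_subgraph G H"
    and "incidence_condition G \<H> Y"
  shows "\<H> = subgraphs_in G Y"
proof -
  have inj: "inj_on incidence_vector {K. is_subgraph G K}"
    using incidence_vector_inj[OF assms(1)] by (auto simp: inj_on_def)
  have "incidence_vector ` \<H> = incidence_vector ` subgraphs_in G Y"
    using assms(4) binary_points_eq[OF assms(1,2)] by (simp add: incidence_condition_def)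
  moreover have "\<H> \<subseteq> {K. is_subgraph G K}" "subgraphs_in G Y \<subseteq> {K. is_subgraph G K}"
    using assms(3) by (auto simp: subgraphs_in_def)
  ultimately show ?thesis
    using inj_on_image_eq_iff[OF inj] by blast
qed

text \<open>Adding a nonnegative vector leaves every coordinate of \<open>H\<close> that equals 1 at
  least 1, and a coordinate of the incidence vector of \<open>K\<close> that is at least 1 belongs
  to \<open>K\<close>.\<close>

lemma incidence_vector_add_imp_subgraph:
  assumes wf: "gcs_wf G" and sub: "is_subgraph G K" "is_subgraph G H"
    and n: "n \<in> nonneg_int_points G" and eq: "incidence_vector K = incidence_vector H + n"
  shows "fst H \<subseteq> fst K" "snd H \<subseteq> snd K"
proof -
  have "i \<in> fst K <+> snd K" if "i \<in> fst H <+> snd H" for i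
  proof -
    have "i \<in> gcs_index G"
      using that sub(2) by (auto simp: is_subgraph_def gcs_index_def)
    then have "0 \<le> Poly_Mapping.lookup n i"
      using n by (auto simp: nonneg_int_points_def Nats_def)
    then have "1 \<le> Poly_Mapping.lookup (incidence_vector K) i"
      using that by (simp add: eq lookup_add lookup_incidence_vector[OF wf sub(2)])
    then show ?thesis
      by (auto simp: lookup_incidence_vector[OF wf sub(1)] split: if_splits)
  qed
  then show "fst H \<subseteq> fst K" "snd H \<subseteq> snd K"
    by blast+
qed

text \<open>Since 0 is a nonnegative integer point, the incidence vector of \<open>K\<close> itself
  lies in the larger sumset, and its decomposition there yields \<open>H\<close>. Equality of
  sumsets allows this in both directions.\<close>

lemma sumset_subset_imp_smaller_subgraph:
  assumes wf: "gcs_wf G" and "\<forall>H\<in>\<A>. is_subgraph G H" "\<forall>K\<in>\<B>. is_subgraph G K"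
    and subset: "incidence_vector ` \<B> + nonneg_int_points G
       \<subseteq> incidence_vector ` \<A> + nonneg_int_points G"
    and K: "K \<in> \<B>"
  obtains H where "H \<in> \<A>" "fst H \<subseteq> fst K" "snd H \<subseteq> snd K"
proof -
  have "0 \<in> nonneg_int_points G"
    by (simp add: nonneg_int_points_def)
  with K have "incidence_vector K + 0 \<in> incidence_vector ` \<B> + nonneg_int_points G"
    by (intro set_plus_intro) auto
  with subset obtain H n where "H \<in> \<A>" "n \<in> nonneg_int_points G"
    "incidence_vector K = incidence_vector H + n"
    by (fastforce elim!: set_plus_elim)
  with incidence_vector_add_imp_subgraph[OF wf] assms(2,3) K that show thesis
    by metis
qed

text \<open>A minimal element of either family below \<open>K\<close> lies in both families.\<close>

lemma mutually_dominating_imp_common: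
  fixes K :: "'v subgr"
  assumes "finite (fst K)" "finite (snd K)" "K \<in> \<A> \<union> \<B>"
    and AB: "\<And>K. K \<in> \<B> \<Longrightarrow> \<exists>H\<in>\<A>. fst H \<subseteq> fst K \<and> snd H \<subseteq> snd K"
    and BA: "\<And>K. K \<in> \<A> \<Longrightarrow> \<exists>H\<in>\<B>. fst H \<subseteq> fst K \<and> snd H \<subseteq> snd K"
  shows "\<exists>H\<in>\<A> \<inter> \<B>. fst H \<subseteq> fst K \<and> snd H \<subseteq> snd K"
  using assms(1-3)
proof (induction "card (fst K) + card (snd K)" arbitrary: K rule: less_induct)
  case less
  \<comment> \<open>If \<open>K\<close> lies in both families, \<open>H\<close> is \<open>K\<close>
    itself. Otherwise the dominating subgraph comes from the family that misses \<open>K\<close>, so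
    it differs from \<open>K\<close> and is strictly smaller.\<close>
  obtain H where H: "H \<in> \<A> \<union> \<B>" "fst H \<subseteq> fst K" "snd H \<subseteq> snd K"
    and other: "K \<in> \<A> \<inter> \<B> \<or> H \<noteq> K"
    using less.prems(3) AB[of K] BA[of K] by blast
  show ?case
  proof (cases "H = K")
    case True
    with other show ?thesis by auto
  next
    case False
    then have "fst H \<subset> fst K \<or> snd H \<subset> snd K"
      using H by (auto simp: prod_eq_iff)
    then have "card (fst H) + card (snd H) < card (fst K) + card (snd K)"
      using H less.prems by (meson add_less_le_mono add_le_less_mono card_mono psubset_card_mono)
    with less.hyps[of H] H less.prems show ?thesis
      by (meson finite_subset subset_trans)
  qed
qed


section \<open>Comparing families of subgraphs\<close>

text \<open>Feasibility with membership in the family split off, so that one point can be tested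
  against different families and subgraphs.\<close>

definition gcs_point :: "'v gcs \<Rightarrow> 'v subgr \<Rightarrow> ('v \<Rightarrow> rvec) \<Rightarrow> bool" where
  "gcs_point G K x \<longleftrightarrow>
     (\<forall>v\<in>fst K. x v \<in> vset G v) \<and> (\<forall>(v, w)\<in>snd K. (x v, x w) \<in> eset G (v, w))"

lemma gcs_feasible_iff: "(K, x) \<in> gcs_feasible G \<A> \<longleftrightarrow> K \<in> \<A> \<and> gcs_point G K x"
  by (cases K) (auto simp: gcs_feasible_def gcs_point_def)

lemma gcs_point_smaller_subgraph:
  assumes "gcs_point G K x" "fst H \<subseteq> fst K" "snd H \<subseteq> snd K"
  shows "gcs_point G H x"
  using assms by (auto simp: gcs_point_def)

text \<open>The dropped terms are objectives evaluated inside their own constraint sets, because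
  \<open>x\<close> is feasible for the larger \<open>K\<close>; there they are nonnegative.\<close>

lemma gcs_cost_smaller_subgraph:
  assumes wf: "gcs_wf G" and K: "is_subgraph G K" "gcs_point G K x"
    and sub: "fst H \<subseteq> fst K" "snd H \<subseteq> snd K" and nonneg: "nonneg_objectives G"
  shows "gcs_cost G (H, x) \<le> gcs_cost G (K, x)"
proof -
  obtain W F where [simp]: "K = (W, F)" by (cases K)
  obtain W' F' where [simp]: "H = (W', F')" by (cases H)
  have fin: "finite W" "finite F"
    using is_subgraph_finite[OF wf K(1)] by auto
  have "(\<Sum>v\<in>W'. vobj G v (x v)) \<le> (\<Sum>v\<in>W. vobj G v (x v))"
    using fin sub K nonneg
    by (intro sum_mono2) (auto simp: gcs_point_def is_subgraph_def nonneg_objectives_def)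
  moreover have "(\<Sum>(v, w)\<in>F'. eobj G (v, w) (x v, x w)) \<le> (\<Sum>(v, w)\<in>F. eobj G (v, w) (x v, x w))"
    using fin sub K nonneg
    by (intro sum_mono2) (force simp: gcs_point_def is_subgraph_def nonneg_objectives_def)+
  ultimately show ?thesis
    by simp
qed

lemma gcs_solution_iff:
  "gcs_solution G \<A> K x \<longleftrightarrow>
     K \<in> \<A> \<and> gcs_point G K x \<and> ereal (gcs_cost G (K, x)) = gcs_value G \<A>"
  unfolding gcs_solution_def is_arg_min_iff_INF gcs_value_def[symmetric]
  by (simp add: gcs_feasible_iff)

text \<open>Meant for the intersection of \<open>\<H>\<close> with \<open>subgraphs_in G Y\<close>,
  as a subfamily of either one.\<close>

lemma gcs_value_subfamily:
  assumes "\<B> \<subseteq> \<A>"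
    and "\<And>K x. K \<in> \<A> \<Longrightarrow> gcs_point G K x \<Longrightarrow>
      \<exists>H\<in>\<B>. gcs_point G H x \<and> gcs_cost G (H, x) \<le> gcs_cost G (K, x)"
  shows "gcs_value G \<B> = gcs_value G \<A>"
proof (rule antisym)
  show "gcs_value G \<B> \<le> gcs_value G \<A>"
    unfolding gcs_value_def
  proof (rule INF_mono)
    fix s assume s: "s \<in> gcs_feasible G \<A>"
    obtain K x where [simp]: "s = (K, x)" by (cases s)
    from s assms(2)[of K x] obtain H where "H \<in> \<B>" "gcs_point G H x"
      "gcs_cost G (H, x) \<le> gcs_cost G s"
      by (auto simp: gcs_feasible_iff)
    then show "\<exists>t\<in>gcs_feasible G \<B>. ereal (gcs_cost G t) \<le> ereal (gcs_cost G s)"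
      by (intro bexI[of _ "(H, x)"]) (auto simp: gcs_feasible_iff)
  qed
  have "gcs_feasible G \<B> \<subseteq> gcs_feasible G \<A>"
    using assms(1) by (auto simp: gcs_feasible_def)
  then show "gcs_value G \<A> \<le> gcs_value G \<B>"
    unfolding gcs_value_def by (rule INF_superset_mono) simp
qed


section \<open>The mixed-integer program as a GCS problem\<close>

lemma micp_feasible_incidence_vector_iff:
  assumes wf: "gcs_wf G" and no_isolated: "\<forall>v\<in>verts G. incident_edges G v \<noteq> {}"
    and sub: "is_subgraph G K"
  shows "(incidence_vector K, z, z') \<in> micp_feasible G Y \<longleftrightarrow>
    K \<in> subgraphs_in G Y \<and> gcs_point G K z \<and>
    (\<forall>v\<in>verts G - fst K. z v = 0) \<and>
    (\<forall>v\<in>verts G. \<forall>e\<in>incident_edges G v. z' v e = (if e \<in> snd K then z v else 0))"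
    (is "?L \<longleftrightarrow> ?R")
proof -
  obtain W F where K: "K = (W, F)" by (cases K)
  have W: "W \<subseteq> verts G" and F: "F \<subseteq> edges G" "F \<subseteq> W \<times> W"
    using sub by (auto simp: is_subgraph_def K)
  have yv: "yv (incidence_vector K) v = (if v \<in> W then 1 else 0)" for v
    using lookup_incidence_vector[OF wf sub] by (auto simp: K)
  have ye: "ye (incidence_vector K) e = (if e \<in> F then 1 else 0)" for e
    using lookup_incidence_vector[OF wf sub] by (auto simp: K)
  have ends: "v \<in> W" if "e \<in> incident_edges G v" "e \<in> F" for v e
    using that F(2) by (auto simp: incident_edges_def)
  note hom = homogenization_0_iff homogenization_1_iff
  \<comment> \<open>By \<open>ends\<close>, \<open>e \<in> F\<close> implies
    \<open>v \<in> W\<close>, so three cases remain. If \<open>e \<in> F\<close>, the difference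
    \<open>z v - z' v e\<close> has scale 0 and vanishes. If \<open>v \<in> W\<close> but
    \<open>e \<notin> F\<close>, then \<open>z' v e\<close> vanishes and the difference has scale 1.
    If \<open>v \<notin> W\<close>, both vanish.\<close>
  have vertex: "(z' v e, ye (incidence_vector K) e) \<in> homogenization (vset G v) \<and>
      (z v - z' v e, yv (incidence_vector K) v - ye (incidence_vector K) e)
        \<in> homogenization (vset G v) \<longleftrightarrow>
      (if v \<in> W then z v \<in> vset G v else z v = 0) \<and> z' v e = (if e \<in> F then z v else 0)"
    if "e \<in> incident_edges G v" for v e
    using ends[OF that] by (auto simp: yv ye hom)
  have vertices: "(\<forall>v\<in>verts G. \<forall>e\<in>incident_edges G v.
        (z' v e, ye (incidence_vector K) e) \<in> homogenization (vset G v) \<and>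
        (z v - z' v e, yv (incidence_vector K) v - ye (incidence_vector K) e)
          \<in> homogenization (vset G v)) \<longleftrightarrow>
      (\<forall>v\<in>W. z v \<in> vset G v) \<and> (\<forall>v\<in>verts G - W. z v = 0) \<and>
      (\<forall>v\<in>verts G. \<forall>e\<in>incident_edges G v. z' v e = (if e \<in> F then z v else 0))"
    (is "?V \<longleftrightarrow> _")
  proof -
    have "?V \<longleftrightarrow> (\<forall>v\<in>verts G. \<forall>e\<in>incident_edges G v.
        (if v \<in> W then z v \<in> vset G v else z v = 0) \<and> z' v e = (if e \<in> F then z v else 0))"
      by (intro ball_cong refl vertex)
    \<comment> \<open>The condition on \<open>z v\<close> does not mention \<open>e\<close>, but it
      leaves the quantifier over incident edges only because each vertex has such an edge.\<close>
    also have "\<dots> \<longleftrightarrow> (\<forall>v\<in>verts G. if v \<in> W then z v \<in> vset G v else z v = 0) \<and>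
        (\<forall>v\<in>verts G. \<forall>e\<in>incident_edges G v. z' v e = (if e \<in> F then z v else 0))"
      using no_isolated by blast
    also have "(\<forall>v\<in>verts G. if v \<in> W then z v \<in> vset G v else z v = 0) \<longleftrightarrow>
        (\<forall>v\<in>W. z v \<in> vset G v) \<and> (\<forall>v\<in>verts G - W. z v = 0)"
      using W by auto
    finally show ?thesis
      by (simp only: conj_assoc)
  qed
  \<comment> \<open>An edge outside \<open>F\<close> contributes the zero pair at scale 0, which is
    always admissible; an edge of \<open>F\<close> contributes the original constraint at scale
    1.\<close>
  have edge_vars: "(\<forall>(v, w)\<in>edges G. ((z' v (v, w), z' w (v, w)), ye (incidence_vector K) (v, w))
        \<in> homogenization (eset G (v, w))) \<longleftrightarrow> (\<forall>(v, w)\<in>F. (z v, z w) \<in> eset G (v, w))"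
    if z': "\<forall>v\<in>verts G. \<forall>e\<in>incident_edges G v. z' v e = (if e \<in> F then z v else 0)"
  proof -
    have "z' v (v, w) = (if (v, w) \<in> F then z v else 0)" "z' w (v, w) = (if (v, w) \<in> F then z w else 0)"
      if "(v, w) \<in> edges G" for v w
      using z' edge_ends[OF wf that] by auto
    then have "((z' v (v, w), z' w (v, w)), ye (incidence_vector K) (v, w))
        \<in> homogenization (eset G (v, w)) \<longleftrightarrow> ((v, w) \<in> F \<longrightarrow> (z v, z w) \<in> eset G (v, w))"
      if "(v, w) \<in> edges G" for v w
      using that by (simp add: ye hom zero_prod_def)
    then show ?thesis
      using F(1) by (auto 0 3)
  qed
  \<comment> \<open>The dimension constraints follow from \<open>?V\<close>: each vector is zero or
    lies in a constraint set inside the right space.\<close>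
  have dims: "(\<forall>v\<in>verts G. z v \<in> Rn (vdim G v)) \<and>
      (\<forall>v\<in>verts G. \<forall>e\<in>incident_edges G v. z' v e \<in> Rn (vdim G v))" if ?V
  proof -
    have "z v \<in> Rn (vdim G v)" if "v \<in> verts G" for v
      using \<open>?V\<close>[unfolded vertices] that vset_in_Rn[OF wf that] by (cases "v \<in> W") auto
    then show ?thesis
      using \<open>?V\<close>[unfolded vertices] by auto
  qed
  have "?L \<longleftrightarrow> incidence_vector K \<in> binary_points G Y \<and> ?V \<and>
      (\<forall>(v, w)\<in>edges G. ((z' v (v, w), z' w (v, w)), ye (incidence_vector K) (v, w))
        \<in> homogenization (eset G (v, w)))"
    using dims unfolding micp_feasible_def mem_Collect_eq case_prod_conv ball_conj_distrib by argo
  also have "\<dots> \<longleftrightarrow> incidence_vector K \<in> binary_points G Y \<and> ?V \<and>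
      (\<forall>(v, w)\<in>F. (z v, z w) \<in> eset G (v, w))"
    \<comment> \<open>\<open>conj_cong\<close> makes the preceding conjunct \<open>?V\<close>
      available, which supplies the formula for \<open>z'\<close> that \<open>edge_vars\<close>
      assumes.\<close>
    by (intro conj_cong refl edge_vars vertices[THEN iffD1, THEN conjunct2, THEN conjunct2])
  also have "\<dots> \<longleftrightarrow> ?R"
    unfolding vertices incidence_vector_in_binary_points_iff[OF wf sub]
    using sub by (auto simp: subgraphs_in_def gcs_point_def K)
  finally show ?thesis .
qed

text \<open>Variables outside \<open>K\<close> are zero and contribute nothing, so both sums shrink
  to the vertices and edges of \<open>K\<close>.\<close>

lemma micp_cost_eq_gcs_cost:
  assumes wf: "gcs_wf G" and lin: "linear_objectives G cv ce" and sub: "is_subgraph G K"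
    and feas: "gcs_point G K x"
    and z: "\<And>v. v \<in> verts G \<Longrightarrow> z v = (if v \<in> fst K then x v else 0)"
    and z': "\<And>v e. v \<in> verts G \<Longrightarrow> e \<in> incident_edges G v \<Longrightarrow> z' v e = (if e \<in> snd K then x v else 0)"
  shows "micp_cost G cv ce (y, z, z') = gcs_cost G (K, x)"
proof -
  obtain W F where K: "K = (W, F)" by (cases K)
  have W: "W \<subseteq> verts G" and F: "F \<subseteq> edges G" "F \<subseteq> W \<times> W"
    using sub by (auto simp: is_subgraph_def K)
  \<comment> \<open>\<open>linear_objectives\<close> identifies the objectives with
    \<open>dotp\<close> only on the coordinate spaces.\<close>
  have x: "x v \<in> Rn (vdim G v)" if "v \<in> W" for v
    using that feas W vset_in_Rn[OF wf, of v "x v"] by (auto simp: gcs_point_def K)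
  have "(\<Sum>v\<in>verts G. dotp (cv v) (z v)) = (\<Sum>v\<in>W. vobj G v (x v))"
    using wf W x lin by (intro sum.mono_neutral_cong_right) (auto simp: gcs_wf_def z linear_objectives_def K)
  moreover have "(\<Sum>(v, w)\<in>edges G. dotp (fst (ce (v, w))) (z' v (v, w)) +
      dotp (snd (ce (v, w))) (z' w (v, w))) = (\<Sum>(v, w)\<in>F. eobj G (v, w) (x v, x w))"
  proof (rule sum.mono_neutral_cong_right)
    have z'_ends: "z' v (v, w) = (if (v, w) \<in> F then x v else 0)"
      "z' w (v, w) = (if (v, w) \<in> F then x w else 0)" if "(v, w) \<in> edges G" for v w
      using z' edge_ends[OF wf that] by (auto simp: K)
    then show "\<forall>e\<in>edges G - F. (case e of (v, w) \<Rightarrow> dotp (fst (ce (v, w))) (z' v (v, w)) +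
        dotp (snd (ce (v, w))) (z' w (v, w))) = 0"
      by auto
    fix e assume "e \<in> F"
    moreover obtain v w where e: "e = (v, w)" by (cases e)
    ultimately have vw: "(v, w) \<in> F" "(v, w) \<in> edges G" "v \<in> W" "w \<in> W"
      using F by auto
    then have "eobj G (v, w) (x v, x w) = dotp (fst (ce (v, w))) (x v) + dotp (snd (ce (v, w))) (x w)"
      using lin x unfolding linear_objectives_def by blast
    then show "(case e of (v, w) \<Rightarrow> dotp (fst (ce (v, w))) (z' v (v, w)) +
        dotp (snd (ce (v, w))) (z' w (v, w))) = (case e of (v, w) \<Rightarrow> eobj G (v, w) (x v, x w))"
      using vw z'_ends by (simp add: e)
  qed (use finite_edges[OF wf] F in auto)
  ultimately show ?thesis
    by (simp add: K)
qed

text \<open>Only the values of \<open>x\<close> on \<open>K\<close> are tied to \<open>z\<close>;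
  this freedom is what the claim about optimal continuous variables requires.\<close>

lemma micp_feasible_imp_gcs_feasible:
  assumes wf: "gcs_wf G" and no_isolated: "\<forall>v\<in>verts G. incident_edges G v \<noteq> {}"
    and lin: "linear_objectives G cv ce" and sub: "is_subgraph G K"
    and feas: "(incidence_vector K, z, z') \<in> micp_feasible G Y"
    and x: "\<And>v. v \<in> fst K \<Longrightarrow> x v = z v"
  shows "(K, x) \<in> gcs_feasible G (subgraphs_in G Y)"
    and "micp_cost G cv ce (incidence_vector K, z, z') = gcs_cost G (K, x)"
proof -
  note F = feas[unfolded micp_feasible_incidence_vector_iff[OF wf no_isolated sub]]
  have x_snd: "x v = z v" if "e \<in> snd K" "e \<in> incident_edges G v" for v e
    using that sub x by (auto simp: is_subgraph_def incident_edges_def)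
  have ends: "fst e \<in> fst K \<and> snd e \<in> fst K" if "e \<in> snd K" for e
    using that sub by (auto simp: is_subgraph_def)
  have feas_x: "gcs_point G K x"
    using F x ends by (fastforce simp: gcs_point_def)
  with F show "(K, x) \<in> gcs_feasible G (subgraphs_in G Y)"
    by (simp add: gcs_feasible_iff)
  show "micp_cost G cv ce (incidence_vector K, z, z') = gcs_cost G (K, x)"
    using F x x_snd by (intro micp_cost_eq_gcs_cost[OF wf lin sub feas_x]) auto
qed

lemma gcs_feasible_imp_micp_feasible:
  assumes wf: "gcs_wf G" and no_isolated: "\<forall>v\<in>verts G. incident_edges G v \<noteq> {}"
    and lin: "linear_objectives G cv ce"
    and feas: "(K, x) \<in> gcs_feasible G (subgraphs_in G Y)"
  obtains z z' where "(incidence_vector K, z, z') \<in> micp_feasible G Y"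
    "micp_cost G cv ce (incidence_vector K, z, z') = gcs_cost G (K, x)"
proof
  \<comment> \<open>The zero extension is forced by
    \<open>micp_feasible_incidence_vector_iff\<close>. In \<open>?z'\<close> the value
    \<open>x v\<close> may replace \<open>?z v\<close>, since the ends of an edge of
    \<open>K\<close> lie in \<open>K\<close>.\<close>
  let ?z = "\<lambda>v. if v \<in> fst K then x v else 0"
  let ?z' = "\<lambda>v e. if e \<in> snd K then x v else 0"
  have K: "K \<in> subgraphs_in G Y" "gcs_point G K x"
    using feas by (auto simp: gcs_feasible_iff)
  then have sub: "is_subgraph G K"
    by (simp add: subgraphs_in_def)
  then have ends: "fst e \<in> fst K \<and> snd e \<in> fst K" if "e \<in> snd K" for e
    using that by (auto simp: is_subgraph_def)
  have "gcs_point G K ?z"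
    using K(2) ends by (fastforce simp: gcs_point_def)
  then show "(incidence_vector K, ?z, ?z') \<in> micp_feasible G Y"
    unfolding micp_feasible_incidence_vector_iff[OF wf no_isolated sub]
    using K ends by (auto simp: incident_edges_def)
  show "micp_cost G cv ce (incidence_vector K, ?z, ?z') = gcs_cost G (K, x)"
    by (rule micp_cost_eq_gcs_cost[OF wf lin sub K(2)]) auto
qed

lemma micp_value_eq_gcs_value:
  assumes wf: "gcs_wf G" and no_isolated: "\<forall>v\<in>verts G. incident_edges G v \<noteq> {}"
    and lin: "linear_objectives G cv ce" and Y: "Y \<subseteq> subgraph_polytope G"
  shows "micp_value G cv ce Y = gcs_value G (subgraphs_in G Y)"
proof (rule antisym)
  show "gcs_value G (subgraphs_in G Y) \<le> micp_value G cv ce Y"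
    unfolding gcs_value_def micp_value_def
  proof (rule INF_mono)
    fix s assume s: "s \<in> micp_feasible G Y"
    obtain y z z' where [simp]: "s = (y, z, z')" by (cases s)
    have "y \<in> binary_points G Y"
      using s by (simp add: micp_feasible_def)
    then obtain K where "K \<in> subgraphs_in G Y" and [simp]: "y = incidence_vector K"
      by (rule binary_point_is_incidence_vector[OF wf Y])
    then have "is_subgraph G K"
      by (simp add: subgraphs_in_def)
    note micp_feasible_imp_gcs_feasible[OF wf no_isolated lin this, of z z' Y z]
    with s show "\<exists>t\<in>gcs_feasible G (subgraphs_in G Y).
        ereal (gcs_cost G t) \<le> ereal (micp_cost G cv ce s)"
      by (intro bexI[of _ "(K, z)"]) auto
  qed
  show "micp_value G cv ce Y \<le> gcs_value G (subgraphs_in G Y)"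
    unfolding gcs_value_def micp_value_def
  proof (rule INF_mono)
    fix s assume s: "s \<in> gcs_feasible G (subgraphs_in G Y)"
    obtain K x where [simp]: "s = (K, x)" by (cases s)
    obtain z z' where "(incidence_vector K, z, z') \<in> micp_feasible G Y"
      "micp_cost G cv ce (incidence_vector K, z, z') = gcs_cost G s"
      using gcs_feasible_imp_micp_feasible[OF wf no_isolated lin, of K x Y] s by auto
    then show "\<exists>t\<in>micp_feasible G Y. ereal (micp_cost G cv ce t) \<le> ereal (gcs_cost G s)"
      by (intro bexI[of _ "(incidence_vector K, z, z')"]) auto
  qed
qed

lemma micp_solution_imp_gcs_solution:
  assumes "gcs_wf G" "\<forall>v\<in>verts G. incident_edges G v \<noteq> {}" "linear_objectives G cv ce"
    and "Y \<subseteq> subgraph_polytope G" "is_subgraph G K"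
    and sol: "micp_solution G cv ce Y (incidence_vector K) z z'"
    and "\<And>v. v \<in> fst K \<Longrightarrow> x v = z v"
  shows "gcs_solution G (subgraphs_in G Y) K x"
proof -
  have "(incidence_vector K, z, z') \<in> micp_feasible G Y"
    "ereal (micp_cost G cv ce (incidence_vector K, z, z')) = micp_value G cv ce Y"
    using sol by (auto simp: micp_solution_def is_arg_min_iff_INF micp_value_def)
  then show ?thesis
    using micp_feasible_imp_gcs_feasible[OF assms(1-3,5), of z z' Y x] assms(7)
    unfolding gcs_solution_iff micp_value_eq_gcs_value[OF assms(1-4)]
    by (metis gcs_feasible_iff)
qed

lemma micp_optimal_vector_iff:
  assumes "gcs_wf G" "\<forall>v\<in>verts G. incident_edges G v \<noteq> {}" "linear_objectives G cv ce"
    and "Y \<subseteq> subgraph_polytope G" "is_subgraph G K"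
  shows "micp_optimal_vector G cv ce Y (incidence_vector K) \<longleftrightarrow>
    gcs_optimal_subgraph G (subgraphs_in G Y) K"
proof
  assume "micp_optimal_vector G cv ce Y (incidence_vector K)"
  then show "gcs_optimal_subgraph G (subgraphs_in G Y) K"
    using micp_solution_imp_gcs_solution[OF assms]
    by (auto simp: micp_optimal_vector_def gcs_optimal_subgraph_def)
next
  assume "gcs_optimal_subgraph G (subgraphs_in G Y) K"
  then obtain x where "(K, x) \<in> gcs_feasible G (subgraphs_in G Y)"
    and cost: "ereal (gcs_cost G (K, x)) = micp_value G cv ce Y"
    unfolding gcs_optimal_subgraph_def gcs_solution_iff micp_value_eq_gcs_value[OF assms(1-4)]
    by (auto simp: gcs_feasible_iff)
  then obtain z z' where "(incidence_vector K, z, z') \<in> micp_feasible G Y"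
    "micp_cost G cv ce (incidence_vector K, z, z') = gcs_cost G (K, x)"
    using gcs_feasible_imp_micp_feasible[OF assms(1-3)] by blast
  with cost show "micp_optimal_vector G cv ce Y (incidence_vector K)"
    unfolding micp_optimal_vector_def micp_solution_def is_arg_min_iff_INF micp_value_def by metis
qed

section \<open>From the incidence conditions to the equivalence\<close>

text \<open>A single conclusion covers both conditions. In the exact case the families coincide and
  \<open>H\<close> is \<open>K\<close>, so the cost bound holds for objectives of any sign. In the
  relaxed case the sumset equality makes the families dominate each other, and nonnegativity gives
  the bound.\<close>

lemma incidence_imp_common_subgraph:
  assumes wf: "gcs_wf G" and admissible: "\<forall>H\<in>\<H>. is_subgraph G H"
    and Y: "Y \<subseteq> subgraph_polytope G"
    and incidence: "incidence_condition G \<H> Y \<or>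
      (nonneg_objectives G \<and> relaxed_incidence_condition G \<H> Y)"
    and K: "K \<in> \<H> \<union> subgraphs_in G Y"
  obtains H where "H \<in> \<H> \<inter> subgraphs_in G Y" "fst H \<subseteq> fst K" "snd H \<subseteq> snd K"
    "\<And>x. gcs_point G K x \<Longrightarrow> gcs_cost G (H, x) \<le> gcs_cost G (K, x)"
proof (cases "incidence_condition G \<H> Y")
  case True
  from K that[of K] incidence_condition_imp_eq[OF wf Y admissible True] show ?thesis
    by simp
next
  case False
  with incidence have nonneg: "nonneg_objectives G" and "relaxed_incidence_condition G \<H> Y"
    by auto
  then have eq: "incidence_vector ` subgraphs_in G Y + nonneg_int_points G =
      incidence_vector ` \<H> + nonneg_int_points G"
    by (simp add: relaxed_incidence_condition_def binary_points_eq[OF wf Y])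
  have sub: "is_subgraph G K"
    using K admissible by (auto simp: subgraphs_in_def)
  have subs: "\<forall>H\<in>subgraphs_in G Y. is_subgraph G H"
    by (simp add: subgraphs_in_def)
  have "\<exists>H\<in>\<H> \<inter> subgraphs_in G Y. fst H \<subseteq> fst K \<and> snd H \<subseteq> snd K"
  proof (rule mutually_dominating_imp_common[OF is_subgraph_finite[OF wf sub] K])
    show "\<exists>H\<in>\<H>. fst H \<subseteq> fst L \<and> snd H \<subseteq> snd L" if "L \<in> subgraphs_in G Y" for L
      by (rule sumset_subset_imp_smaller_subgraph[OF wf admissible subs equalityD1[OF eq] that]) blast
    show "\<exists>H\<in>subgraphs_in G Y. fst H \<subseteq> fst L \<and> snd H \<subseteq> snd L" if "L \<in> \<H>" for L
      by (rule sumset_subset_imp_smaller_subgraph[OF wf subs admissible equalityD2[OF eq] that]) blast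
  qed
  with that gcs_cost_smaller_subgraph[OF wf sub _ _ _ nonneg] show ?thesis
    by blast
qed

text \<open>Under the relaxed condition an optimal subgraph of one problem may be missing from the
  other family. The equivalence is therefore restricted to common subgraphs, and the last two
  conjuncts pass to a smaller subgraph that is optimal for both problems.\<close>

theorem theorem1:
  fixes G :: "'v gcs"
    and cv :: "'v \<Rightarrow> rvec"
    and ce :: "'v \<times> 'v \<Rightarrow> rvec \<times> rvec"
    and \<H> :: "'v subgr set"
    and Y :: "'v ivec set"
  assumes wf: "gcs_wf G"
    and no_isolated: "\<forall>v\<in>verts G. incident_edges G v \<noteq> {}"
    and vsets: "\<forall>v\<in>verts G. closed (vset G v) \<and> convex (vset G v) \<and> bounded (vset G v)"
    and esets: "\<forall>e\<in>edges G. closed (eset G e) \<and> convex (eset G e) \<and> bounded (eset G e)"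
    and lin: "linear_objectives G cv ce"
    and admissible: "\<forall>H\<in>\<H>. is_subgraph G H"
    and Y: "polytope Y" "Y \<subseteq> subgraph_polytope G"
    and incidence: "incidence_condition G \<H> Y \<or>
                    (nonneg_objectives G \<and> relaxed_incidence_condition G \<H> Y)"
  shows
    "micp_value G cv ce Y = gcs_value G \<H> \<and>

     (\<forall>H. is_subgraph G H \<longrightarrow>
         incidence_condition G \<H> Y \<or> (H \<in> \<H> \<and> incidence_vector H \<in> Y) \<longrightarrow>
         (gcs_optimal_subgraph G \<H> H \<longleftrightarrow>
          micp_optimal_vector G cv ce Y (incidence_vector H))) \<and>

     (\<forall>H y z z' x. is_subgraph G H \<longrightarrow>
         incidence_condition G \<H> Y \<or> H \<in> \<H> \<longrightarrow>
         y = incidence_vector H \<longrightarrow> micp_solution G cv ce Y y z z' \<longrightarrow>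
         (\<forall>v\<in>verts G. yv y v = 1 \<longrightarrow> x v = z v) \<longrightarrow>
         gcs_solution G \<H> H x) \<and>

     (\<forall>H. gcs_optimal_subgraph G \<H> H \<longrightarrow>
         (\<exists>H'\<in>\<H>. fst H' \<subseteq> fst H \<and> snd H' \<subseteq> snd H \<and>
            gcs_optimal_subgraph G \<H> H' \<and>
            micp_optimal_vector G cv ce Y (incidence_vector H'))) \<and>

     (\<forall>H y z z' x. is_subgraph G H \<longrightarrow>
         y = incidence_vector H \<longrightarrow> micp_solution G cv ce Y y z z' \<longrightarrow>
         (\<forall>v\<in>verts G. yv y v = 1 \<longrightarrow> x v = z v) \<longrightarrow>
         (\<exists>H'\<in>\<H>. fst H' \<subseteq> fst H \<and> snd H' \<subseteq> snd H \<and>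
            gcs_solution G \<H> H' x \<and>
            micp_optimal_vector G cv ce Y (incidence_vector H')))"
proof -
  let ?B = "subgraphs_in G Y"
  note setting = wf no_isolated lin Y(2)
  note common = incidence_imp_common_subgraph[OF wf admissible Y(2) incidence]
  have eq_if: "\<H> = ?B" if "incidence_condition G \<H> Y"
    using incidence_condition_imp_eq[OF wf Y(2) admissible that] .
  \<comment> \<open>The intersection dominates both families, so it has the value of each.\<close>
  have "\<exists>H\<in>\<H> \<inter> ?B. gcs_point G H x \<and> gcs_cost G (H, x) \<le> gcs_cost G (K, x)"
    if "K \<in> \<H> \<union> ?B" "gcs_point G K x" for K x
    using common[OF that(1)] gcs_point_smaller_subgraph[OF that(2)] that(2) by metis
  then have "gcs_value G (\<H> \<inter> ?B) = gcs_value G \<H>" "gcs_value G (\<H> \<inter> ?B) = gcs_value G ?B"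
    by (auto intro!: gcs_value_subfamily)
  then have same_value: "gcs_value G ?B = gcs_value G \<H>"
    by simp
  have transfer: "gcs_solution G \<H> H x \<longleftrightarrow> gcs_solution G ?B H x" if "H \<in> \<H> \<inter> ?B" for H x
    using that by (simp add: gcs_solution_iff same_value)
  have optimal_iff: "gcs_optimal_subgraph G \<H> H \<longleftrightarrow>
      micp_optimal_vector G cv ce Y (incidence_vector H)" if "H \<in> \<H> \<inter> ?B" for H
    using that admissible
    by (simp add: micp_optimal_vector_iff[OF setting] gcs_optimal_subgraph_def transfer)
  \<comment> \<open>The common subgraph \<open>H'\<close> keeps the same \<open>x\<close>. Its cost
    is at most the optimal value by domination and at least that value by feasibility.\<close>
  have descend: "\<exists>H'\<in>\<H>. fst H' \<subseteq> fst H \<and> snd H' \<subseteq> snd H \<and> gcs_solution G \<H> H' x \<and>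
      micp_optimal_vector G cv ce Y (incidence_vector H')"
    if sol: "gcs_solution G \<H> H x \<or> gcs_solution G ?B H x" for H x
  proof -
    have H: "H \<in> \<H> \<union> ?B" "gcs_point G H x"
      "ereal (gcs_cost G (H, x)) = gcs_value G \<H>"
      using sol same_value by (auto simp: gcs_solution_iff)
    obtain H' where H': "H' \<in> \<H> \<inter> ?B" "fst H' \<subseteq> fst H" "snd H' \<subseteq> snd H"
      "gcs_cost G (H', x) \<le> gcs_cost G (H, x)"
      using common[OF H(1)] H(2) by metis
    have feas: "gcs_point G H' x"
      using gcs_point_smaller_subgraph[OF H(2) H'(2,3)] .
    with H' have "(H', x) \<in> gcs_feasible G \<H>"
      by (auto simp: gcs_feasible_iff)
    then have "gcs_value G \<H> \<le> ereal (gcs_cost G (H', x))"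
      unfolding gcs_value_def by (rule INF_lower)
    with H(3) H'(4) have "ereal (gcs_cost G (H', x)) = gcs_value G \<H>"
      by (metis antisym ereal_less_eq(3))
    with H' feas have "gcs_solution G \<H> H' x"
      by (simp add: gcs_solution_iff)
    with H' optimal_iff[of H'] show ?thesis
      by (auto simp: gcs_optimal_subgraph_def)
  qed
  have micp_sol: "gcs_solution G ?B H x"
    if "is_subgraph G H" "micp_solution G cv ce Y (incidence_vector H) z z'"
      "\<forall>v\<in>verts G. yv (incidence_vector H) v = 1 \<longrightarrow> x v = z v" for H z z' x
  proof (rule micp_solution_imp_gcs_solution[OF setting that(1,2)])
    fix v assume "v \<in> fst H"
    then have "v \<in> verts G" "yv (incidence_vector H) v = 1"
      using that(1) lookup_incidence_vector[OF wf that(1), of "Inl v"] by (auto simp: is_subgraph_def)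
    with that(3) show "x v = z v"
      by blast
  qed
  have optimal_iff_if: "gcs_optimal_subgraph G \<H> H \<longleftrightarrow>
      micp_optimal_vector G cv ce Y (incidence_vector H)"
    if "is_subgraph G H" "incidence_condition G \<H> Y \<or> (H \<in> \<H> \<and> incidence_vector H \<in> Y)" for H
    using that eq_if optimal_iff[of H] micp_optimal_vector_iff[OF setting that(1)]
    by (auto simp: subgraphs_in_def)
  have solution_if: "gcs_solution G \<H> H x"
    if "gcs_solution G ?B H x" "incidence_condition G \<H> Y \<or> H \<in> \<H>" for H x
    using that eq_if transfer[of H x] by (auto simp: gcs_solution_iff)
  show ?thesis
  proof (intro conjI allI impI)
    show "micp_value G cv ce Y = gcs_value G \<H>"
      by (simp add: micp_value_eq_gcs_value[OF setting] same_value)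
  next
    fix H assume "gcs_optimal_subgraph G \<H> H"
    then show "\<exists>H'\<in>\<H>. fst H' \<subseteq> fst H \<and> snd H' \<subseteq> snd H \<and> gcs_optimal_subgraph G \<H> H' \<and>
        micp_optimal_vector G cv ce Y (incidence_vector H')"
      using descend[of H] unfolding gcs_optimal_subgraph_def by blast
  next
    \<comment> \<open>This block closes two goals: the first \<open>show\<close> precedes the
      assumption on the incidence condition or \<open>H \<in> \<H>\<close>, the second one uses
      it.\<close>
    fix H y z z' x
    assume "is_subgraph G H" "y = incidence_vector H" "micp_solution G cv ce Y y z z'"
      "\<forall>v\<in>verts G. yv y v = 1 \<longrightarrow> x v = z v"
    then have sol: "gcs_solution G ?B H x"
      using micp_sol by blast
    then show "\<exists>H'\<in>\<H>. fst H' \<subseteq> fst H \<and> snd H' \<subseteq> snd H \<and> gcs_solution G \<H> H' x \<and>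
        micp_optimal_vector G cv ce Y (incidence_vector H')"
      using descend by blast
    assume "incidence_condition G \<H> Y \<or> H \<in> \<H>"
    with sol show "gcs_solution G \<H> H x"
      by (rule solution_if)
  qed (fact optimal_iff_if)
qed

end
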